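(* Let $\lambda>0$, let $G$ be a probability distribution on $(0,\infty)$, and let $(V_t^{1,x})_{t\ge 0}$, $x\in[0,1]$, be the Model 1 workload process with arrival rate $\lambda$ and service distribution $G$. Let $\pi$ be its (unique) invariant distribution on $[0,1]$. Then $\pi$ has a density $\bar\pi$ on $(0,1]$, given for $x\in(0,1]$ by $$\bar{\pi}(x)=\frac{\sum_{i=1}^{\infty}\lambda^{i}\,\bar{G}^{\ast i}(x)}{1+\sum_{i=1}^{\infty}\lambda^{i}\int_{0}^1\bar{G}^{\ast i}(y)\,dy},$$ and, writing $\pi(x)=\pi([0,x])$, for $x\in[0,1]$, $$\pi(x)=\frac{1+\sum_{i=1}^{\infty}\lambda^{i}\int_{0}^{x}\bar{G}^{\ast i}(y)\,dy}{1+\sum_{i=1}^{\infty}\lambda^{i}\int_{0}^1\bar{G}^{\ast i}(y)\,dy}.$$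
   Context: Model 1 (M/G/1 workload with truncated service at capacity 1). Let $T_0=0$ and let the inter-arrival times $T_i-T_{i-1}$, $i\ge1$, be i.i.d. exponential with mean $1/\lambda$; let $(S_n)_{n\ge1}$ be i.i.d. with distribution $G$ on $(0,\infty)$, independent of $(T_n)$. For $x\in[0,1]$ define $V^{1,x}_0=x$, $$V^{1,x}_t=\max[V^{1,x}_{T_{n-1}}-(t-T_{n-1}),0]\quad (T_{n-1}\le t<T_n,\ n\ge1),\qquad V^{1,x}_{T_n}=\min[S_n+V^{1,x}_{T_n-},\,1]\quad(n\ge1),$$ where $V^{1,x}_{T_n-}$ is the left limit at $T_n$. This is a Markov process on $[0,1]$ with a unique invariant probability distribution $\pi$ (which has an atom at $0$). Notation: $\bar G(x)=1-G(x)=\mathbb{P}(S_1>x)$, where $G(x)$ also denotes the distribution function. For functions on $[0,\infty)$, $(f\ast g)(x)=\int_0^x f(x-y)g(y)\,dy$; $\bar G^{\ast 1}=\bar G$ and $\bar G^{\ast (i+1)}=\bar G\ast\bar G^{\ast i}$. *)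

theory Defs
  imports "HOL-Probability.Probability"
begin

text \<open>
  Sample paths of the workload with truncated service at capacity 1, driven by arrival epochs
  \<open>\<tau> 0 = 0 < \<tau> 1 < \<tau> 2 < \<dots>\<close> and service times \<open>s 1, s 2, \<dots>\<close> (the value \<open>s 0\<close> is not used).
  \<open>workload_at \<tau> s x n\<close> is the workload at the epoch \<open>\<tau> n\<close>, immediately after the jump.
  The term \<open>max (\<dots>) 0\<close> in the recursion is the left limit of the path at \<open>\<tau> (Suc n)\<close>; see
  \<open>workload_arrival\<close> below.
\<close>

primrec workload_at :: "(nat \<Rightarrow> real) \<Rightarrow> (nat \<Rightarrow> real) \<Rightarrow> real \<Rightarrow> nat \<Rightarrow> real" where
  "workload_at \<tau> s x 0 = x"
| "workload_at \<tau> s x (Suc n) =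
     min (s (Suc n) + max (workload_at \<tau> s x n - (\<tau> (Suc n) - \<tau> n)) 0) 1"

text \<open>For \<open>t \<ge> 0\<close> the least \<open>n\<close> with \<open>t < \<tau> (Suc n)\<close> is the one with \<open>\<tau> n \<le> t < \<tau> (Suc n)\<close>.\<close>

definition workload :: "(nat \<Rightarrow> real) \<Rightarrow> (nat \<Rightarrow> real) \<Rightarrow> real \<Rightarrow> real \<Rightarrow> real" where
  "workload \<tau> s x t =
     (let n = (LEAST n. t < \<tau> (Suc n)) in max (workload_at \<tau> s x n - (t - \<tau> n)) 0)"

context
  fixes \<tau> s :: "nat \<Rightarrow> real" and x :: real
  assumes mono: "strict_mono \<tau>" and zero: "\<tau> 0 = 0"
    and pos: "\<And>n. 0 < s (Suc n)" and x: "x \<in> {0..1}"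
begin

lemma workload_at_bounds: "workload_at \<tau> s x n \<in> {0..1}"
  using x pos by (cases n) (auto simp: min_def max_def less_imp_le add_nonneg_nonneg)

lemma workload_interval:
  assumes "\<tau> n \<le> t" "t < \<tau> (Suc n)"
  shows "workload \<tau> s x t = max (workload_at \<tau> s x n - (t - \<tau> n)) 0"
proof -
  have "(LEAST n. t < \<tau> (Suc n)) = n"
  proof (rule Least_equality)
    fix m assume "t < \<tau> (Suc m)"
    with assms(1) have "\<tau> n < \<tau> (Suc m)" by simp
    then show "n \<le> m" using mono by (simp add: strict_mono_less)
  qed (rule assms(2))
  then show ?thesis by (simp add: workload_def)
qed

lemma workload_epoch: "workload \<tau> s x (\<tau> n) = workload_at \<tau> s x n"
  using workload_interval[of n "\<tau> n"] workload_at_bounds[of n] mono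
  by (simp add: strict_mono_less)

lemma workload_start: "workload \<tau> s x 0 = x"
  using workload_epoch[of 0] zero by simp

lemma workload_between:
  assumes "\<tau> n \<le> t" "t < \<tau> (Suc n)"
  shows "workload \<tau> s x t = max (workload \<tau> s x (\<tau> n) - (t - \<tau> n)) 0"
  using workload_interval[OF assms] workload_epoch by simp

lemma workload_arrival:
  "workload \<tau> s x (\<tau> (Suc n)) =
     min (s (Suc n) + Lim (at_left (\<tau> (Suc n))) (workload \<tau> s x)) 1"
proof -
  let ?f = "\<lambda>t. max (workload_at \<tau> s x n - (t - \<tau> n)) 0"
  have lt: "\<tau> n < \<tau> (Suc n)" using mono by (simp add: strict_mono_less)
  have "(?f \<longlongrightarrow> ?f (\<tau> (Suc n))) (at_left (\<tau> (Suc n)))"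
    by (intro tendsto_intros)
  moreover have "\<forall>\<^sub>F t in at_left (\<tau> (Suc n)). ?f t = workload \<tau> s x t"
    using eventually_at_left_real[OF lt]
    by eventually_elim (auto simp: workload_interval[of n])
  ultimately have "(workload \<tau> s x \<longlongrightarrow> ?f (\<tau> (Suc n))) (at_left (\<tau> (Suc n)))"
    by (rule Lim_transform_eventually)
  then have "Lim (at_left (\<tau> (Suc n))) (workload \<tau> s x) = ?f (\<tau> (Suc n))"
    by (intro tendsto_Lim) auto
  then show ?thesis by (simp add: workload_epoch)
qed

end

locale mg1_input = prob_space M + G: prob_space G
  for M :: "'a measure" and lambda :: real and G :: "real measure"
    and T S :: "nat \<Rightarrow> 'a \<Rightarrow> real" +
  assumes lambda_pos: "0 < lambda"
    and sets_G: "sets G = sets borel"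
    and G_pos: "measure G {0<..} = 1"
    and T_0: "\<And>\<omega>. \<omega> \<in> space M \<Longrightarrow> T 0 \<omega> = 0"
    and T_distributed:
      "\<And>i. distributed M lborel (\<lambda>\<omega>. T (Suc i) \<omega> - T i \<omega>) (exponential_density lambda)"
    and T_indep: "indep_vars (\<lambda>_. borel) (\<lambda>i \<omega>. T (Suc i) \<omega> - T i \<omega>) UNIV"
    and S_distr: "\<And>n. 1 \<le> n \<Longrightarrow> distr M borel (S n) = G"
    and S_indep: "indep_vars (\<lambda>_. borel) S {1..}"
    and T_S_indep:
      "indep_var (Pi\<^sub>M UNIV (\<lambda>_. borel)) (\<lambda>\<omega>. \<lambda>n\<in>UNIV. T n \<omega>)
                 (Pi\<^sub>M {1..} (\<lambda>_. borel)) (\<lambda>\<omega>. \<lambda>n\<in>{1..}. S n \<omega>)"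

definition invariant_distribution ::
  "'a measure \<Rightarrow> (nat \<Rightarrow> 'a \<Rightarrow> real) \<Rightarrow> (nat \<Rightarrow> 'a \<Rightarrow> real) \<Rightarrow> real measure \<Rightarrow> bool" where
  "invariant_distribution M T S \<pi> \<longleftrightarrow>
     prob_space \<pi> \<and> sets \<pi> = sets borel \<and> measure \<pi> {0..1} = 1 \<and>
     (\<forall>t\<ge>0. \<forall>B\<in>sets borel.
        (\<integral>\<^sup>+x. emeasure M {\<omega> \<in> space M. workload (\<lambda>n. T n \<omega>) (\<lambda>n. S n \<omega>) x t \<in> B} \<partial>\<pi>)
          = emeasure \<pi> B)"

definition tail :: "real measure \<Rightarrow> real \<Rightarrow> real" where
  "tail G x = measure G {x<..}"

definition conv :: "(real \<Rightarrow> real) \<Rightarrow> (real \<Rightarrow> real) \<Rightarrow> real \<Rightarrow> real" where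
  "conv f g x = (LINT y:{0..x}|lborel. f (x - y) * g y)"

text \<open>\<open>conv_power f i\<close> is the \<open>i\<close>-fold convolution power for \<open>i \<ge> 1\<close>; the value at \<open>0\<close> is a
  dummy and is never used.\<close>

fun conv_power :: "(real \<Rightarrow> real) \<Rightarrow> nat \<Rightarrow> real \<Rightarrow> real" where
  "conv_power f 0 = (\<lambda>_. 0)"
| "conv_power f (Suc 0) = f"
| "conv_power f (Suc (Suc n)) = conv f (conv_power f (Suc n))"

end

theory Submission imports Defs begin

text \<open>Compare \<open>\<pi>\<close> with its image under the dynamics over a short time \<open>h\<close>: up to probability \<open>O(h\<^sup>2)\<close>
  there is at most one arrival. For the distribution function \<open>F\<close> of \<open>\<pi>\<close> and \<open>K(z) = P(X + S \<le> z)\<close>, with \<open>X \<sim> \<pi>\<close>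
  independent of \<open>S \<sim> G\<close>, this gives \<open>F(z + h) - F(z) = \<lambda>h (F(z) - K(z))\<close> with an error that sums to \<open>O(h)\<close>
  over a partition of step \<open>h\<close> by monotonicity of \<open>F\<close> and \<open>K\<close>. Hence \<open>\<pi>\<close> has on \<open>(0,1]\<close> the density
  \<open>p = \<lambda>(F - K)\<close>. As \<open>F(z) - K(z)\<close> is the integral of \<open>1 - G(z - x)\<close> over \<open>\<pi>(dx)\<close>, \<open>x \<le> z\<close>, this density solves the
  renewal equation with kernel \<open>\<lambda>(1 - G)\<close> and inhomogeneity \<open>\<pi>{0} \<lambda>(1 - G)\<close>. Its Neumann series is the
  claimed one, and \<open>\<pi>{0}\<close> is found by normalisation.\<close>

section \<open>Convolution powers and the renewal equation\<close>

text \<open>Over \<open>n + 1\<close> equal pieces the bounds on the increments telescope to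
  \<open>(b - a) * (\<Psi> b - \<Psi> a) / (n + 1)\<close>, which tends to 0. This takes the place
  of a vanishing derivative when \<open>F\<close> minus the integral of \<open>p\<close> is shown to
  be constant.\<close>

lemma eq_if_increments_le_mono:
  fixes D \<Psi> :: "real \<Rightarrow> real"
  assumes ab: "a \<le> b"
    and inc: "\<And>x y. a \<le> x \<Longrightarrow> x < y \<Longrightarrow> y \<le> b \<Longrightarrow> \<bar>D y - D x\<bar> \<le> (y - x) * (\<Psi> y - \<Psi> x)"
  shows "D b = D a"
proof (cases "a = b")
  case False
  with ab have "a < b" by simp
  have bound: "\<bar>D b - D a\<bar> \<le> (b - a) * (\<Psi> b - \<Psi> a) * inverse (real (Suc n))" for n
  proof -
    define t where "t k = a + real k * ((b - a) / real (Suc n))" for k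
    have t0: "t 0 = a" and tn: "t (Suc n) = b" by (simp_all add: t_def)
    have step: "t (Suc k) - t k = (b - a) / real (Suc n)" for k
      by (simp add: t_def distrib_right del: of_nat_Suc) (simp add: distrib_right add_divide_distrib diff_divide_distrib)
    have "mono t" unfolding t_def using \<open>a < b\<close> by (intro monoI add_left_mono mult_right_mono) auto
    then have t_in: "a \<le> t k" "k \<le> Suc n \<Longrightarrow> t k \<le> b" for k
      using t0 tn by (metis monoD le0, metis monoD)
    have "\<bar>D b - D a\<bar> = \<bar>\<Sum>k<Suc n. D (t (Suc k)) - D (t k)\<bar>"
      by (subst sum_lessThan_telescope) (simp only: t0 tn)
    also have "\<dots> \<le> (\<Sum>k<Suc n. \<bar>D (t (Suc k)) - D (t k)\<bar>)" by (rule sum_abs)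
    also have "\<dots> \<le> (\<Sum>k<Suc n. (b - a) / real (Suc n) * (\<Psi> (t (Suc k)) - \<Psi> (t k)))"
    proof (rule sum_mono)
      fix k assume "k \<in> {..<Suc n}"
      moreover have "t k < t (Suc k)"
        using step[of k] \<open>a < b\<close> by (smt (verit) divide_pos_pos of_nat_0_less_iff zero_less_Suc)
      ultimately show "\<bar>D (t (Suc k)) - D (t k)\<bar> \<le> (b - a) / real (Suc n) * (\<Psi> (t (Suc k)) - \<Psi> (t k))"
        using inc[of "t k" "t (Suc k)"] t_in(1)[of k] t_in(2)[of "Suc k"] by (simp only: step) simp
    qed
    also have "\<dots> = (b - a) / real (Suc n) * (\<Psi> b - \<Psi> a)"
      by (subst sum_distrib_left[symmetric], subst sum_lessThan_telescope) (simp only: t0 tn)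
    finally show ?thesis by (simp add: field_simps)
  qed
  have "(\<lambda>n. (b - a) * (\<Psi> b - \<Psi> a) * inverse (real (Suc n))) \<longlonglongrightarrow> (b - a) * (\<Psi> b - \<Psi> a) * 0"
    by (intro tendsto_intros LIMSEQ_inverse_real_of_nat)
  then have "\<bar>D b - D a\<bar> \<le> 0"
    using bound by (intro LIMSEQ_le_const) (auto simp del: of_nat_Suc)
  then show ?thesis by simp
qed simp

lemma set_integrable_Icc_bounded:
  fixes g :: "real \<Rightarrow> real"
  assumes "g \<in> borel_measurable borel" "\<And>y. y \<in> {a..b} \<Longrightarrow> \<bar>g y\<bar> \<le> C"
  shows "set_integrable lborel {a..b} g"
proof (rule set_integrable_bound[where f = "\<lambda>_. C"])
  show "set_integrable lborel {a..b} (\<lambda>_. C)"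
    unfolding set_integrable_def
    by (rule borel_integrable_atLeastAtMost'[unfolded set_integrable_def]) simp
  show "set_borel_measurable lborel {a..b} g"
    using assms(1) by (simp add: set_borel_measurable_def)
  show "AE x in lborel. x \<in> {a..b} \<longrightarrow> norm (g x) \<le> norm C"
    using assms(2) by (intro AE_I2) (force simp: abs_le_iff)
qed

lemma set_integral_abs_le:
  fixes g h :: "real \<Rightarrow> real"
  assumes "set_integrable lborel A g" "set_integrable lborel A h" "\<And>y. y \<in> A \<Longrightarrow> \<bar>g y\<bar> \<le> h y"
  shows "\<bar>LINT y:A|lborel. g y\<bar> \<le> (LINT y:A|lborel. h y)"
proof -
  have "\<bar>LINT y:A|lborel. g y\<bar> \<le> (LINT y:A|lborel. \<bar>g y\<bar>)"
    using set_integral_norm_bound[OF assms(1)] by simp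
  also have "\<dots> \<le> (LINT y:A|lborel. h y)"
    using assms by (intro set_integral_mono set_integrable_abs) auto
  finally show ?thesis .
qed

text \<open>The domain \<open>{0..x}\<close> moves with the argument. Written as a condition inside
  the integrand, it leaves an integral of a jointly measurable function over one of its
  variables.\<close>

lemma borel_measurable_conv:
  assumes [measurable]: "f \<in> borel_measurable borel" "g \<in> borel_measurable borel"
  shows "conv f g \<in> borel_measurable borel"
proof -
  have "(\<lambda>x. LINT y|lborel. (if 0 \<le> y \<and> y \<le> x then f (x - y) * g y else 0)) \<in> borel_measurable borel"
    by measurable
  also have "(\<lambda>x. LINT y|lborel. (if 0 \<le> y \<and> y \<le> x then f (x - y) * g y else 0)) = conv f g"
    by (auto simp: fun_eq_iff conv_def set_lebesgue_integral_def intro!: Bochner_Integration.integral_cong split: split_indicator)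
  finally show ?thesis .
qed

lemma LINT_Icc_scaled_power:
  fixes z :: real
  assumes "0 \<le> z"
  shows "c * (LINT y:{0..z}|lborel. C * (c * y) ^ n / fact n) = C * (c * z) ^ Suc n / fact (Suc n)"
proof -
  have "(LINT y:{0..z}|lborel. C * (c * y) ^ n / fact n) = C * c ^ n / fact n * (LINT y:{0..z}|lborel. y ^ n)"
    by (subst set_integral_mult_right[symmetric]) (simp add: power_mult_distrib)
  also have "(LINT y:{0..z}|lborel. y ^ n) = z ^ Suc n / Suc n"
    using integral_power[OF assms, of n] by (simp add: set_lebesgue_integral_def mult.commute)
  finally show ?thesis by (simp add: power_mult_distrib mult_ac)
qed

section \<open>Factorial bounds for convolution powers of a bounded kernel\<close>

context
  fixes f :: "real \<Rightarrow> real"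
  assumes f_measurable [measurable]: "f \<in> borel_measurable borel" and f_le: "\<And>x. \<bar>f x\<bar> \<le> 1"
begin

lemma set_integrable_conv:
  assumes [measurable]: "g \<in> borel_measurable borel" and "\<And>y. y \<in> {0..z} \<Longrightarrow> \<bar>g y\<bar> \<le> C"
  shows "set_integrable lborel {0..z} (\<lambda>y. f (z - y) * g y)"
proof (rule set_integrable_Icc_bounded)
  fix y assume "y \<in> {0..z}"
  then show "\<bar>f (z - y) * g y\<bar> \<le> 1 * C"
    unfolding abs_mult using assms(2) f_le by (intro mult_mono) auto
qed measurable

text \<open>Since |f| is at most 1, convolution with \<open>f\<close> costs no more than integrating
  the bound over \<open>{0..z}\<close>, and this turns one term of an exponential series into the
  next. It drives the induction both for the convolution powers and for the remainders of the
  Neumann series.\<close>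

lemma conv_power_growth:
  assumes g: "g \<in> borel_measurable borel" and c: "0 \<le> c" and z: "0 \<le> z" and C: "0 \<le> C"
    and bound: "\<And>y. y \<in> {0..z} \<Longrightarrow> \<bar>g y\<bar> \<le> C * (c * y) ^ n / fact n"
  shows "\<bar>c * conv f g z\<bar> \<le> C * (c * z) ^ Suc n / fact (Suc n)"
proof -
  \<comment> \<open>The value of the bound at the right end is constant in \<open>y\<close> and
    serves integrability; the bound depending on \<open>y\<close> is the one that gets
    integrated.\<close>
  have "\<bar>g y\<bar> \<le> C * (c * z) ^ n / fact n" if "y \<in> {0..z}" for y
    using bound[OF that] that c C
    by (elim order_trans) (auto intro!: divide_right_mono mult_left_mono power_mono)
  then have "\<bar>conv f g z\<bar> \<le> (LINT y:{0..z}|lborel. C * (c * y) ^ n / fact n)"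
    unfolding conv_def
  proof (intro set_integral_abs_le set_integrable_conv[OF g])
    show "set_integrable lborel {0..z} (\<lambda>y. C * (c * y) ^ n / fact n)"
      by (intro borel_integrable_atLeastAtMost' continuous_intros) auto
    fix y assume "y \<in> {0..z}"
    then show "\<bar>f (z - y) * g y\<bar> \<le> C * (c * y) ^ n / fact n"
      using mult_mono[OF f_le bound] by (auto simp: abs_mult)
  qed
  then have "c * \<bar>conv f g z\<bar> \<le> c * (LINT y:{0..z}|lborel. C * (c * y) ^ n / fact n)"
    using c by (rule mult_left_mono)
  then show ?thesis using c LINT_Icc_scaled_power[OF z, of c C n] by (simp add: abs_mult)
qed

lemma borel_measurable_conv_power [measurable]: "conv_power f i \<in> borel_measurable borel"
proof (induction i)
  case (Suc i)
  then show ?case by (cases i) (auto intro: borel_measurable_conv)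
qed simp

text \<open>The exponent is \<open>i\<close> and not \<open>Suc i\<close> because the
  \<open>Suc i\<close>-fold power involves only \<open>i\<close> integrations.\<close>

lemma conv_power_le: "0 \<le> z \<Longrightarrow> \<bar>conv_power f (Suc i) z\<bar> \<le> z ^ i / fact i"
proof (induction i arbitrary: z)
  case (Suc i)
  then show ?case
    using conv_power_growth[OF borel_measurable_conv_power, where c = 1 and C = 1 and n = i] by simp
qed (use f_le in simp)

lemma summable_conv_power:
  assumes "0 \<le> c" "0 \<le> z"
  shows "summable (\<lambda>i. c ^ Suc i * conv_power f (Suc i) z)"
proof (rule summable_comparison_test')
  show "summable (\<lambda>i. c * ((c * z) ^ i / fact i))"
    by (intro summable_mult) (use summable_exp[of "c * z"] in \<open>simp add: divide_inverse mult.commute\<close>)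
  show "norm (c ^ Suc i * conv_power f (Suc i) z) \<le> c * ((c * z) ^ i / fact i)" for i
    using mult_left_mono[OF conv_power_le[OF assms(2), of i], of "c ^ Suc i"] assms(1)
    by (simp add: abs_mult power_mult_distrib mult_ac)
qed

lemma conv_power_set_integrable: "set_integrable lborel {0..x} (conv_power f (Suc i))"
proof (rule set_integrable_Icc_bounded)
  fix y assume "y \<in> {0..x}"
  then show "\<bar>conv_power f (Suc i) y\<bar> \<le> x ^ i / fact i"
    by (intro order_trans[OF conv_power_le]) (auto intro!: divide_right_mono power_mono)
qed measurable

text \<open>Integrating \<open>y ^ i / fact i\<close> over \<open>{0..x}\<close> again gives terms
  of an exponential series.\<close>

lemma summable_integral_conv_power:
  assumes c: "0 \<le> c" and x: "0 \<le> x"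
  shows "summable (\<lambda>i. c ^ Suc i * (LINT y:{0..x}|lborel. conv_power f (Suc i) y))"
proof (rule summable_comparison_test')
  show "summable (\<lambda>i. (c * x) ^ Suc i / fact (Suc i))"
    using summable_exp[of "c * x"]
    by (subst summable_Suc_iff) (simp add: divide_inverse mult.commute)
  fix i :: nat
  have "\<bar>LINT y:{0..x}|lborel. conv_power f (Suc i) y\<bar> \<le> (LINT y:{0..x}|lborel. 1 * (1 * y) ^ i / fact i)"
    by (intro set_integral_abs_le conv_power_set_integrable borel_integrable_atLeastAtMost' continuous_intros)
      (use conv_power_le in auto)
  also have "\<dots> = x ^ Suc i / fact (Suc i)"
    using LINT_Icc_scaled_power[OF x, of 1 1 i] by simp
  finally show "norm (c ^ Suc i * (LINT y:{0..x}|lborel. conv_power f (Suc i) y)) \<le> (c * x) ^ Suc i / fact (Suc i)"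
    using mult_left_mono[of _ _ "c ^ Suc i"] c
    by (fastforce simp: abs_mult power_mult_distrib simp del: power_Suc fact_Suc)
qed

section \<open>Neumann series of the renewal equation\<close>

context
  fixes p :: "real \<Rightarrow> real" and c u C :: real
  assumes p_measurable [measurable]: "p \<in> borel_measurable borel"
    and p_le: "\<And>x. x \<in> {0..1} \<Longrightarrow> \<bar>p x\<bar> \<le> C" and c_nonneg: "0 \<le> c"
    and renewal: "\<And>x. x \<in> {0..1} \<Longrightarrow> p x = c * (u * f x + conv f p x)"
begin

definition renewal_remainder :: "nat \<Rightarrow> real \<Rightarrow> real" where
  "renewal_remainder n x = p x - (\<Sum>i<n. u * (c ^ Suc i * conv_power f (Suc i) x))"

lemma renewal_remainder_Suc:
  "renewal_remainder (Suc n) x = renewal_remainder n x - u * c ^ Suc n * conv_power f (Suc n) x"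
  by (simp add: renewal_remainder_def mult_ac)

lemma borel_measurable_renewal_remainder [measurable]: "renewal_remainder n \<in> borel_measurable borel"
  unfolding renewal_remainder_def by measurable

lemma renewal_bound_nonneg: "0 \<le> C"
  using p_le[of 0] by simp

text \<open>For \<open>n = 0\<close> the recursion is the renewal equation itself, and linearity of
  the convolution carries it on. The two claims share one induction: the bound at \<open>n\<close>
  gives the integrability on which linearity rests, and the recursion together with
  \<open>conv_power_growth\<close> gives the bound at \<open>Suc n\<close>.\<close>

lemma renewal_remainder_recursion:
  assumes "x \<in> {0..1}"
  shows "\<bar>renewal_remainder n x\<bar> \<le> C * (c * x) ^ n / fact n"
    and "renewal_remainder (Suc n) x = c * conv f (renewal_remainder n) x"
proof -
  have "\<forall>x\<in>{0..1}. \<bar>renewal_remainder n x\<bar> \<le> C * (c * x) ^ n / fact n \<and>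
      renewal_remainder (Suc n) x = c * conv f (renewal_remainder n) x"
  proof (induction n)
    case 0
    have "renewal_remainder 0 = p" by (simp add: fun_eq_iff renewal_remainder_def)
    then show ?case
      using p_le by (auto simp: renewal_remainder_Suc renewal algebra_simps)
  next
    case (Suc n)
    show ?case
    proof
      fix x :: real assume x: "x \<in> {0..1}"
      have bound: "\<bar>renewal_remainder n y\<bar> \<le> C * (c * y) ^ n / fact n" if "y \<in> {0..x}" for y
        using Suc.IH x that by auto
      have le: "C * (c * y) ^ n / fact n \<le> C * (c * x) ^ n / fact n" if "y \<in> {0..x}" for y
        using that c_nonneg renewal_bound_nonneg
        by (intro divide_right_mono mult_left_mono power_mono) auto
      have int: "set_integrable lborel {0..x} (\<lambda>y. f (x - y) * renewal_remainder n y)"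
        by (rule set_integrable_conv) (measurable, use bound le order_trans in blast)
      have int': "set_integrable lborel {0..x} (\<lambda>y. f (x - y) * conv_power f (Suc n) y)"
      proof (rule set_integrable_conv)
        fix y assume "y \<in> {0..x}"
        then show "\<bar>conv_power f (Suc n) y\<bar> \<le> x ^ n / fact n"
          by (intro order_trans[OF conv_power_le]) (auto intro!: divide_right_mono power_mono)
      qed measurable
      have "conv f (renewal_remainder (Suc n)) x =
          (LINT y:{0..x}|lborel. f (x - y) * renewal_remainder n y - (u * c ^ Suc n) * (f (x - y) * conv_power f (Suc n) y))"
        unfolding conv_def renewal_remainder_Suc by (simp only: right_diff_distrib mult_ac)
      also have "\<dots> = conv f (renewal_remainder n) x - (u * c ^ Suc n) * conv f (conv_power f (Suc n)) x"
        unfolding conv_def using int int'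
        by (subst set_integral_diff) (auto simp only: set_integrable_mult_right set_integral_mult_right)
      finally have "c * conv f (renewal_remainder (Suc n)) x = renewal_remainder (Suc n) x - u * c ^ Suc (Suc n) * conv_power f (Suc (Suc n)) x"
        using Suc.IH x by (simp add: right_diff_distrib mult_ac)
      moreover have "\<bar>renewal_remainder (Suc n) x\<bar> \<le> C * (c * x) ^ Suc n / fact (Suc n)"
        using conv_power_growth[OF borel_measurable_renewal_remainder c_nonneg _ renewal_bound_nonneg bound, of x] Suc.IH x by simp
      ultimately show "\<bar>renewal_remainder (Suc n) x\<bar> \<le> C * (c * x) ^ Suc n / fact (Suc n) \<and>
          renewal_remainder (Suc (Suc n)) x = c * conv f (renewal_remainder (Suc n)) x"
        by (simp only: renewal_remainder_Suc[of "Suc n"] simp_thms)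
    qed
  qed
  with assms show "\<bar>renewal_remainder n x\<bar> \<le> C * (c * x) ^ n / fact n"
    "renewal_remainder (Suc n) x = c * conv f (renewal_remainder n) x" by auto
qed

text \<open>As \<open>x ^ n\<close> is at most 1, the bound becomes uniform in \<open>x\<close>, so
  that it controls the series pointwise and after integration.\<close>

lemma renewal_remainder_le: "x \<in> {0..1} \<Longrightarrow> \<bar>renewal_remainder n x\<bar> \<le> C * (c ^ n / fact n)"
proof (rule order_trans[OF renewal_remainder_recursion(1)], assumption)
  assume "x \<in> {0..1}"
  then show "C * (c * x) ^ n / fact n \<le> C * (c ^ n / fact n)"
    using renewal_bound_nonneg c_nonneg power_le_one[of x n]
    by (auto simp: power_mult_distrib divide_right_mono mult_left_mono mult_left_le)
qed

lemma renewal_remainder_bound_tendsto: "(\<lambda>n. C * (c ^ n / fact n)) \<longlonglongrightarrow> 0"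
  using tendsto_mult_right_zero[OF summable_LIMSEQ_zero[OF summable_exp[of c]], of C]
  by (simp add: divide_inverse mult.commute)

lemma renewal_solution_sums:
  assumes "x \<in> {0..1}"
  shows "(\<lambda>i. u * (c ^ Suc i * conv_power f (Suc i) x)) sums p x"
proof -
  have "(\<lambda>n. renewal_remainder n x) \<longlonglongrightarrow> 0"
    by (rule tendsto_rabs_zero_cancel, rule tendsto_sandwich[OF _ _ tendsto_const renewal_remainder_bound_tendsto])
      (use renewal_remainder_le[OF assms] in auto)
  from tendsto_diff[OF tendsto_const this, of "p x"] show ?thesis
    by (simp add: renewal_remainder_def sums_def)
qed

lemma set_integrable_renewal_remainder: "x \<le> 1 \<Longrightarrow> set_integrable lborel {0..x} (renewal_remainder n)"
  by (rule set_integrable_Icc_bounded[where C = "C * (c ^ n / fact n)"]) (auto simp del: times_divide_eq_right intro: renewal_remainder_le)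

text \<open>The integral of the remainder is the remainder of the integrated series. Since
  \<open>{0..x}\<close> has length at most 1, the uniform bound on the remainder passes to its
  integral.\<close>

lemma renewal_solution_integral_sums:
  assumes x: "x \<in> {0..1}"
  shows "(\<lambda>i. u * (c ^ Suc i * (LINT y:{0..x}|lborel. conv_power f (Suc i) y))) sums (LINT y:{0..x}|lborel. p y)"
proof -
  have eq: "(LINT y:{0..x}|lborel. renewal_remainder n y) = (LINT y:{0..x}|lborel. p y) -
      (\<Sum>i<n. u * (c ^ Suc i * (LINT y:{0..x}|lborel. conv_power f (Suc i) y)))" for n
  proof (induction n)
    case (Suc n)
    have "(LINT y:{0..x}|lborel. renewal_remainder (Suc n) y) = (LINT y:{0..x}|lborel. renewal_remainder n y) -
        u * c ^ Suc n * (LINT y:{0..x}|lborel. conv_power f (Suc n) y)"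
      unfolding renewal_remainder_Suc using set_integrable_renewal_remainder x conv_power_set_integrable
      by (subst set_integral_diff) (auto simp only: set_integrable_mult_right set_integral_mult_right atLeastAtMost_iff)
    with Suc.IH show ?case by (simp add: mult_ac)
  qed (simp add: renewal_remainder_def)
  have "\<bar>LINT y:{0..x}|lborel. renewal_remainder n y\<bar> \<le> C * (c ^ n / fact n)" for n
  proof -
    have "\<bar>LINT y:{0..x}|lborel. renewal_remainder n y\<bar> \<le> (LINT y:{0..x}|lborel. C * (c ^ n / fact n))"
      using x by (intro set_integral_abs_le set_integrable_renewal_remainder borel_integrable_atLeastAtMost' continuous_intros)
        (auto simp del: times_divide_eq_right intro: renewal_remainder_le)
    also have "\<dots> = x * (C * (c ^ n / fact n))"
      using x by (simp add: set_lebesgue_integral_def)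
    also have "\<dots> \<le> C * (c ^ n / fact n)"
      using x renewal_bound_nonneg c_nonneg by (intro mult_left_le_one_le) auto
    finally show ?thesis .
  qed
  then have "(\<lambda>n. LINT y:{0..x}|lborel. renewal_remainder n y) \<longlonglongrightarrow> 0"
    by (intro tendsto_rabs_zero_cancel[OF tendsto_sandwich[OF _ _ tendsto_const renewal_remainder_bound_tendsto]]) auto
  from tendsto_diff[OF tendsto_const this, of "LINT y:{0..x}|lborel. p y"] show ?thesis
    by (simp add: eq sums_def)
qed

end

end

section \<open>The workload over a short time interval\<close>

lemma workload_before_first_arrival:
  assumes "\<tau> 0 = 0" "t < \<tau> 1"
  shows "workload \<tau> s x t = max (x - t) 0"
proof -
  have "(LEAST n. t < \<tau> (Suc n)) = 0" using assms by (intro Least_equality) auto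
  then show ?thesis using assms by (simp add: workload_def)
qed

lemma workload_between_first_arrivals:
  assumes "\<tau> 0 = 0" "\<tau> 1 \<le> t" "t < \<tau> 2"
  shows "workload \<tau> s x t = max (min (s 1 + max (x - \<tau> 1) 0) 1 - (t - \<tau> 1)) 0"
proof -
  have "(LEAST n. t < \<tau> (Suc n)) = 1"
  proof (rule Least_equality)
    show "t < \<tau> (Suc 1)" using assms by (simp add: numeral_2_eq_2)
    fix m assume "t < \<tau> (Suc m)"
    with assms show "1 \<le> m" by (cases m) auto
  qed
  then show ?thesis using assms by (simp add: workload_def)
qed

text \<open>Without an arrival the workload falls by at most \<open>h\<close>. With one arrival it
  is at least \<open>s 1 + x - h\<close> at time \<open>h\<close>, provided the jump is not
  truncated. The cases compare \<open>h\<close> with the interarrival time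
  \<open>\<tau> 2 - \<tau> 1\<close> rather than with \<open>\<tau> 2\<close>, so that the last
  alternative is an intersection of two independent events, each of probability of order
  \<open>h\<close>.\<close>

lemma workload_le_cases:
  assumes "\<tau> 0 = 0" "0 < \<tau> 1" "0 \<le> z" "z + h \<le> 1" and le: "workload \<tau> s x h \<le> z"
  shows "x \<le> z + h \<and> h < \<tau> 1 \<or> \<tau> 1 \<le> h \<and> s 1 \<le> z + h - x \<or> \<tau> 1 \<le> h \<and> \<tau> 2 - \<tau> 1 \<le> h"
proof -
  consider "h < \<tau> 1" | "\<tau> 1 \<le> h" "h < \<tau> 2 - \<tau> 1" | "\<tau> 1 \<le> h" "\<tau> 2 - \<tau> 1 \<le> h"
    by linarith
  then show ?thesis
  proof cases
    case 1
    then have "max (x - h) 0 \<le> z"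
      using le workload_before_first_arrival[of \<tau> h s x, OF assms(1)] by simp
    with 1 show ?thesis by linarith
  next
    case 2
    then have "max (min (s 1 + max (x - \<tau> 1) 0) 1 - (h - \<tau> 1)) 0 \<le> z"
      using le assms(2) workload_between_first_arrivals[of \<tau> h s x, OF assms(1)] by simp
    then have "min (s 1 + max (x - \<tau> 1) 0) 1 \<le> z + h - \<tau> 1" by linarith
    \<comment> \<open>The level just after the jump is below the capacity, so the minimum with 1 is
      attained by its first argument. The strict inequality comes from
      \<open>0 < \<tau> 1\<close>.\<close>
    moreover have "z + h - \<tau> 1 < 1" using assms by simp
    ultimately have "s 1 + max (x - \<tau> 1) 0 \<le> z + h - \<tau> 1" by linarith
    moreover have "x - \<tau> 1 \<le> max (x - \<tau> 1) 0" by simp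
    ultimately have "s 1 \<le> z + h - x" by linarith
    with 2 show ?thesis by simp
  qed simp
qed

section \<open>Probabilities of few arrivals in a short time\<close>

context mg1_input
begin

lemma measurable_T [measurable]: "T n \<in> borel_measurable M"
proof -
  have "(\<lambda>f. f n) \<circ> (\<lambda>\<omega>. \<lambda>n\<in>UNIV. T n \<omega>) \<in> borel_measurable M"
    by (rule measurable_comp[OF indep_var_rv1[OF T_S_indep]]) simp
  then show ?thesis by (simp add: comp_def)
qed

text \<open>As for \<open>T\<close>, each coordinate is a projection of the random sequence in
  \<open>T_S_indep\<close>. The index is \<open>Suc n\<close> because that sequence of service times
  starts at 1.\<close>

lemma measurable_S [measurable]: "S (Suc n) \<in> borel_measurable M"
proof -
  have "(\<lambda>f. f (Suc n)) \<circ> (\<lambda>\<omega>. \<lambda>n\<in>{1..}. S n \<omega>) \<in> borel_measurable M"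
    by (rule measurable_comp[OF indep_var_rv2[OF T_S_indep]]) simp
  then show ?thesis by (simp add: comp_def)
qed

lemma measurable_workload_at [measurable]:
  "(\<lambda>\<omega>. workload_at (\<lambda>n. T n \<omega>) (\<lambda>n. S n \<omega>) x n) \<in> borel_measurable M"
  by (induction n) (auto intro!: borel_measurable_min borel_measurable_max borel_measurable_add borel_measurable_diff)

lemma measurable_workload [measurable]:
  "(\<lambda>\<omega>. workload (\<lambda>n. T n \<omega>) (\<lambda>n. S n \<omega>) x t) \<in> borel_measurable M"
  unfolding workload_def Let_def
  \<comment> \<open>The index of the current interval is random but takes countably many values, so
    it is enough to treat each fixed index.\<close>
  by (rule measurable_compose_countable[where g = "\<lambda>\<omega>. LEAST n. t < T (Suc n) \<omega>"]) measurable

lemma interarrival_le: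
  assumes "0 \<le> h"
  shows "prob {\<omega> \<in> space M. T (Suc i) \<omega> - T i \<omega> \<le> h} = 1 - exp (- lambda * h)"
  using exponential_distributedD_le[OF T_distributed assms lambda_pos] by (simp add: mult.commute)

text \<open>The arrival times are ordered only almost surely. This is why the two bounds below
  compare events up to null sets.\<close>

lemma T_1_pos: "AE \<omega> in M. 0 < T 1 \<omega>"
proof -
  have "prob {\<omega> \<in> space M. 0 < T (Suc 0) \<omega> - T 0 \<omega>} = 1"
    using exponential_distributedD_gt[OF T_distributed _ lambda_pos, of 0 0] by simp
  then have "AE \<omega> in M. 0 < T (Suc 0) \<omega> - T 0 \<omega>" by (subst prob_Collect_eq_1[symmetric]) auto
  with AE_space show ?thesis by eventually_elim (simp add: T_0)
qed

lemma first_interarrivals_indep: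
  assumes "A \<in> sets borel" "B \<in> sets borel"
  shows "prob {\<omega> \<in> space M. T 1 \<omega> \<in> A \<and> T 2 \<omega> - T 1 \<omega> \<in> B} =
    prob {\<omega> \<in> space M. T 1 \<omega> \<in> A} * prob {\<omega> \<in> space M. T 2 \<omega> - T 1 \<omega> \<in> B}"
proof -
  let ?X = "\<lambda>i \<omega>. T (Suc i) \<omega> - T i \<omega>" and ?A = "\<lambda>i::nat. if i = 0 then A else B"
  have "prob (\<Inter>i\<in>{0,1}. ?X i -` ?A i \<inter> space M) = (\<Prod>i\<in>{0,1}. prob (?X i -` ?A i \<inter> space M))"
    by (rule indep_varsD[OF T_indep]) (use assms in auto)
  moreover have "(\<Inter>i\<in>{0,1}. ?X i -` ?A i \<inter> space M) = {\<omega> \<in> space M. T 1 \<omega> \<in> A \<and> T 2 \<omega> - T 1 \<omega> \<in> B}"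
    by (auto simp: T_0 numeral_2_eq_2)
  moreover have "?X 0 -` A \<inter> space M = {\<omega> \<in> space M. T 1 \<omega> \<in> A}" by (auto simp: T_0)
  moreover have "?X 1 -` B \<inter> space M = {\<omega> \<in> space M. T 2 \<omega> - T 1 \<omega> \<in> B}" by (auto simp: numeral_2_eq_2)
  ultimately show ?thesis by simp
qed

text \<open>With \<open>P\<close> an arbitrary event of the arrival sequence, the lemma covers both
  "an arrival by time \<open>h\<close>" and "an arrival by time \<open>h\<close>, followed by a gap
  longer than \<open>h\<close>".\<close>

lemma arrivals_service_indep:
  assumes P: "Measurable.pred (PiM UNIV (\<lambda>_. borel)) P"
  shows "prob {\<omega> \<in> space M. P (\<lambda>n. T n \<omega>) \<and> S 1 \<omega> \<le> c} = prob {\<omega> \<in> space M. P (\<lambda>n. T n \<omega>)} * cdf G c"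
proof -
  let ?A = "\<lambda>\<omega>. \<lambda>n\<in>UNIV. T n \<omega>" and ?B = "\<lambda>\<omega>. \<lambda>n\<in>{1..}. S n \<omega>"
  let ?Xa = "{f \<in> space (PiM UNIV (\<lambda>_::nat. borel)). P f}"
  let ?Xb = "{f \<in> space (PiM {1::nat..} (\<lambda>_. borel :: real measure)). f 1 \<le> c}"
  have "(\<lambda>f. f 1) \<in> borel_measurable (PiM {1::nat..} (\<lambda>_. borel :: real measure))"
    by (rule measurable_component_singleton) simp
  then have Xb: "?Xb \<in> sets (PiM {1..} (\<lambda>_. borel))" by measurable
  have Xa: "?Xa \<in> sets (PiM UNIV (\<lambda>_. borel))" using P by measurable
  have "prob ((\<lambda>\<omega>. (?A \<omega>, ?B \<omega>)) -` (?Xa \<times> ?Xb) \<inter> space M) = prob (?A -` ?Xa \<inter> space M) * prob (?B -` ?Xb \<inter> space M)"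
    by (rule indep_varD[OF T_S_indep Xa Xb])
  moreover have "(\<lambda>\<omega>. (?A \<omega>, ?B \<omega>)) -` (?Xa \<times> ?Xb) \<inter> space M = {\<omega> \<in> space M. P (\<lambda>n. T n \<omega>) \<and> S 1 \<omega> \<le> c}"
    by (auto simp: space_PiM restrict_def PiE_def extensional_def)
  moreover have "?A -` ?Xa \<inter> space M = {\<omega> \<in> space M. P (\<lambda>n. T n \<omega>)}"
    by (auto simp: space_PiM restrict_def)
  moreover have "?B -` ?Xb \<inter> space M = S 1 -` {..c} \<inter> space M"
    by (auto simp: space_PiM restrict_def PiE_def extensional_def)
  moreover have "prob (S 1 -` {..c} \<inter> space M) = cdf G c"
    using S_distr[of 1] measure_distr[of "S 1" M borel "{..c}"] measurable_S[of 0] by (simp add: cdf_def)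
  ultimately show ?thesis by simp
qed

lemma prob_T_1_gt: "0 \<le> h \<Longrightarrow> prob {\<omega> \<in> space M. h < T 1 \<omega>} = exp (- lambda * h)"
proof -
  assume "0 \<le> h"
  moreover have "{\<omega> \<in> space M. h < T (Suc 0) \<omega> - T 0 \<omega>} = {\<omega> \<in> space M. h < T 1 \<omega>}"
    by (auto simp: T_0)
  ultimately show ?thesis
    using exponential_distributedD_gt[OF T_distributed _ lambda_pos, of h 0] by (simp add: mult.commute)
qed

lemma prob_T_1_le: "0 \<le> h \<Longrightarrow> prob {\<omega> \<in> space M. T 1 \<omega> \<le> h} = 1 - exp (- lambda * h)"
proof -
  assume "0 \<le> h"
  moreover have "{\<omega> \<in> space M. T (Suc 0) \<omega> - T 0 \<omega> \<le> h} = {\<omega> \<in> space M. T 1 \<omega> \<le> h}"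
    by (auto simp: T_0)
  ultimately show ?thesis using interarrival_le[of h 0] by simp
qed

text \<open>Here \<open>q\<close> is the probability that an interarrival time is at most
  \<open>h\<close>. Two disjoint events suffice for a workload at most \<open>z\<close>: no arrival
  and \<open>x \<le> z + h\<close>, or one arrival, then a gap longer than \<open>h\<close>, with
  \<open>S 1 \<le> z - x\<close>. In the second the workload never exceeds \<open>x\<close> plus the
  service time after the jump.\<close>

lemma prob_workload_le_lower:
  assumes "0 \<le> z" "0 < h" "0 \<le> x" and q: "q = 1 - exp (- lambda * h)"
  shows "(1 - q) * indicator {..z + h} x + q * (1 - q) * cdf G (z - x)
    \<le> prob {\<omega> \<in> space M. workload (\<lambda>n. T n \<omega>) (\<lambda>n. S n \<omega>) x h \<le> z}"
proof -
  let ?E = "{\<omega> \<in> space M. x \<le> z + h \<and> h < T 1 \<omega>}"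
  let ?P = "\<lambda>\<tau>. \<tau> 1 \<le> h \<and> h < \<tau> 2 - \<tau> (1::nat)"
  let ?E' = "{\<omega> \<in> space M. ?P (\<lambda>n. T n \<omega>) \<and> S 1 \<omega> \<le> z - x}"
  have [measurable]: "S 1 \<in> borel_measurable M" using measurable_S[of 0] by simp
  have "prob ?E = (1 - q) * indicator {..z + h} x"
    using prob_T_1_gt[of h] \<open>0 < h\<close> q by (auto split: split_indicator)
  moreover have "prob ?E' = q * (1 - q) * cdf G (z - x)"
  proof -
    have "prob {\<omega> \<in> space M. ?P (\<lambda>n. T n \<omega>)} = q * (1 - q)"
      using first_interarrivals_indep[of "{..h}" "{h<..}"] prob_T_1_le[of h]
        exponential_distributedD_gt[OF T_distributed _ lambda_pos, of h 1] \<open>0 < h\<close> q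
      by (simp add: mult.commute numeral_2_eq_2)
    then show ?thesis by (subst arrivals_service_indep) auto
  qed
  moreover have "prob (?E \<union> ?E') = prob ?E + prob ?E'"
    by (rule finite_measure_Union) auto
  moreover have "prob (?E \<union> ?E') \<le> prob {\<omega> \<in> space M. workload (\<lambda>n. T n \<omega>) (\<lambda>n. S n \<omega>) x h \<le> z}"
  proof (rule finite_measure_mono_AE)
    show "AE \<omega> in M. \<omega> \<in> ?E \<union> ?E' \<longrightarrow> \<omega> \<in> {\<omega> \<in> space M. workload (\<lambda>n. T n \<omega>) (\<lambda>n. S n \<omega>) x h \<le> z}"
      using T_1_pos AE_space
    proof eventually_elim
      fix \<omega> assume \<omega>: "0 < T 1 \<omega>" "\<omega> \<in> space M"
      then show "\<omega> \<in> ?E \<union> ?E' \<longrightarrow> \<omega> \<in> {\<omega> \<in> space M. workload (\<lambda>n. T n \<omega>) (\<lambda>n. S n \<omega>) x h \<le> z}"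
        using assms(1-3) T_0[of \<omega>] workload_before_first_arrival[of "\<lambda>n. T n \<omega>" h]
          workload_between_first_arrivals[of "\<lambda>n. T n \<omega>" h]
        by auto
    qed
  qed measurable
  ultimately show ?thesis by simp
qed

text \<open>A union bound over the three alternatives of \<open>workload_le_cases\<close>; the term
  \<open>q * q\<close> pays for two short interarrival times.\<close>

lemma prob_workload_le_upper:
  assumes "0 \<le> z" "0 < h" "z + h \<le> 1" and q: "q = 1 - exp (- lambda * h)"
  shows "prob {\<omega> \<in> space M. workload (\<lambda>n. T n \<omega>) (\<lambda>n. S n \<omega>) x h \<le> z}
    \<le> (1 - q) * indicator {..z + h} x + q * cdf G (z + h - x) + q * q"
proof -
  let ?E = "{\<omega> \<in> space M. x \<le> z + h \<and> h < T 1 \<omega>}"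
  let ?P = "\<lambda>\<tau>. \<tau> (1::nat) \<le> h"
  let ?E' = "{\<omega> \<in> space M. ?P (\<lambda>n. T n \<omega>) \<and> S 1 \<omega> \<le> z + h - x}"
  let ?E'' = "{\<omega> \<in> space M. T 1 \<omega> \<le> h \<and> T 2 \<omega> - T 1 \<omega> \<le> h}"
  have [measurable]: "S 1 \<in> borel_measurable M" using measurable_S[of 0] by simp
  have "prob {\<omega> \<in> space M. workload (\<lambda>n. T n \<omega>) (\<lambda>n. S n \<omega>) x h \<le> z} \<le> prob (?E \<union> ?E' \<union> ?E'')"
  proof (rule finite_measure_mono_AE)
    show "AE \<omega> in M. \<omega> \<in> {\<omega> \<in> space M. workload (\<lambda>n. T n \<omega>) (\<lambda>n. S n \<omega>) x h \<le> z} \<longrightarrow> \<omega> \<in> ?E \<union> ?E' \<union> ?E''"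
      using T_1_pos AE_space
    proof eventually_elim
      fix \<omega> assume \<omega>: "0 < T 1 \<omega>" "\<omega> \<in> space M"
      have "\<omega> \<in> ?E \<union> ?E' \<union> ?E''" if "workload (\<lambda>n. T n \<omega>) (\<lambda>n. S n \<omega>) x h \<le> z"
        using workload_le_cases[OF T_0[OF \<omega>(2)] \<omega>(1) assms(1,3) that] \<omega>(2) by auto
      then show "\<omega> \<in> {\<omega> \<in> space M. workload (\<lambda>n. T n \<omega>) (\<lambda>n. S n \<omega>) x h \<le> z} \<longrightarrow> \<omega> \<in> ?E \<union> ?E' \<union> ?E''"
        by blast
    qed
  qed measurable
  also have "prob (?E \<union> ?E' \<union> ?E'') \<le> prob ?E + prob ?E' + prob ?E''"
  proof -
    have ev: "?E \<in> events" "?E' \<in> events" "?E'' \<in> events" by measurable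
    show ?thesis
      using measure_Un_le[OF sets.Un[OF ev(1,2)] ev(3)] measure_Un_le[OF ev(1,2)] by linarith
  qed
  finally have "prob {\<omega> \<in> space M. workload (\<lambda>n. T n \<omega>) (\<lambda>n. S n \<omega>) x h \<le> z} \<le> prob ?E + prob ?E' + prob ?E''" .
  moreover have "prob ?E = (1 - q) * indicator {..z + h} x"
    using prob_T_1_gt[of h] \<open>0 < h\<close> q by (auto split: split_indicator)
  moreover have "prob ?E' = q * cdf G (z + h - x)"
    using prob_T_1_le[of h] \<open>0 < h\<close> q by (subst arrivals_service_indep) auto
  moreover have "prob ?E'' = q * q"
    using first_interarrivals_indep[of "{..h}" "{..h}"] prob_T_1_le[of h] interarrival_le[of h 1] \<open>0 < h\<close> q
    by (auto simp: numeral_2_eq_2)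
  ultimately show ?thesis by simp
qed

end

sublocale mg1_input \<subseteq> G: real_distribution G
  using sets_G by unfold_locales auto

context mg1_input
begin

lemma cdf_G_neg: "x < 0 \<Longrightarrow> cdf G x = 0"
proof -
  assume "x < 0"
  then have "cdf G x + measure G {0<..} = measure G ({..x} \<union> {0<..})"
    unfolding cdf_def by (subst G.finite_measure_Union) auto
  also have "\<dots> \<le> 1" by simp
  finally show ?thesis using G_pos by (simp add: cdf_def measure_le_0_iff)
qed

lemma tail_eq: "tail G x = 1 - cdf G x"
  using G.prob_compl[of "{..x}"] by (simp add: tail_def cdf_def Compl_eq_Diff_UNIV[symmetric])

lemma measurable_cdf_G [measurable]: "cdf G \<in> borel_measurable borel"
  by (intro borel_measurable_mono monoI G.cdf_nondecreasing)

lemma measurable_tail [measurable]: "tail G \<in> borel_measurable borel"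
  unfolding tail_eq[abs_def] by measurable

lemma abs_tail_le: "\<bar>tail G x\<bar> \<le> 1"
  by (simp add: tail_def)

end

section \<open>One-step inequalities for the distribution function of an invariant law\<close>

locale mg1_invariant = mg1_input M lambda G T S for M :: "'a measure" and lambda G T S +
  fixes \<pi> :: "real measure"
  assumes invariant: "invariant_distribution M T S \<pi>"

sublocale mg1_invariant \<subseteq> pi: real_distribution \<pi>
  using invariant unfolding invariant_distribution_def
  by (intro real_distribution.intro real_distribution_axioms.intro) auto

context mg1_invariant
begin

definition F :: "real \<Rightarrow> real" where "F = cdf \<pi>"
definition K :: "real \<Rightarrow> real" where "K z = (LINT x|\<pi>. cdf G (z - x))"

definition p :: "real \<Rightarrow> real" where "p z = lambda * (F z - K z)"

lemma integrable_bounded: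
  "g \<in> borel_measurable borel \<Longrightarrow> (\<And>x. \<bar>g x\<bar> \<le> C) \<Longrightarrow> integrable \<pi> (g :: real \<Rightarrow> real)"
  by (rule pi.integrable_const_bound[where B = C]) auto

lemma integrable_cdf_G: "integrable \<pi> (\<lambda>x. cdf G (z - x))"
  by (rule integrable_bounded[where C = 1]) (auto simp: G.cdf_nonneg G.cdf_bounded_prob)

lemma F_eq: "F z = (LINT x|\<pi>. indicator {..z} x)"
  by (simp add: F_def cdf_def)

lemma integrable_indicator_atMost: "integrable \<pi> (indicator {..z} :: real \<Rightarrow> real)"
  by (rule integrable_bounded[where C = 1]) (auto split: split_indicator)

lemma AE_pi: "AE x in \<pi>. x \<in> {0..1}"
  using invariant by (subst pi.AE_in_set_eq_1) (auto simp: invariant_distribution_def)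

lemma F_mono: "x \<le> y \<Longrightarrow> F x \<le> F y"
  unfolding F_def by (rule pi.cdf_nondecreasing)

lemma F_le_1: "F x \<le> 1"
  unfolding F_def by (rule pi.cdf_bounded_prob)

lemma K_mono: "x \<le> y \<Longrightarrow> K x \<le> K y"
  unfolding K_def by (intro integral_mono integrable_cdf_G G.cdf_nondecreasing) auto

lemma K_nonneg: "0 \<le> K x"
  unfolding K_def by (intro integral_nonneg_AE) (auto simp: G.cdf_nonneg)

text \<open>For \<open>x > z\<close> the value \<open>cdf G (z - x)\<close> vanishes because
  \<open>G\<close> lives on the positive half-line. The formula gives \<open>K \<le> F\<close> and
  is the source of the renewal equation.\<close>

lemma F_minus_K: "F z - K z = (LINT x|\<pi>. indicator {..z} x * tail G (z - x))"
proof -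
  have "F z - K z = (LINT x|\<pi>. indicator {..z} x - cdf G (z - x))"
    unfolding F_eq K_def
    by (rule Bochner_Integration.integral_diff[symmetric, OF integrable_indicator_atMost integrable_cdf_G])
  also have "(\<lambda>x. indicator {..z} x - cdf G (z - x)) = (\<lambda>x. indicator {..z} x * tail G (z - x))"
    by (auto simp: fun_eq_iff tail_eq cdf_G_neg split: split_indicator)
  finally show ?thesis .
qed

lemma K_le_F: "K z \<le> F z"
proof -
  have "0 \<le> F z - K z" unfolding F_minus_K
    by (intro integral_nonneg_AE) (auto simp: tail_def)
  then show ?thesis by simp
qed

lemma F_nonneg: "0 \<le> F x"
  using K_nonneg K_le_F by (rule order_trans)

text \<open>The nonnegative integral is monotone for arbitrary integrands, so bounds on the
  probability can be integrated directly; a Bochner integral would call for measurability in the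
  starting point \<open>x\<close>.\<close>

lemma F_invariant:
  assumes "0 \<le> h"
  shows "ennreal (F z) = (\<integral>\<^sup>+x. ennreal (prob {\<omega> \<in> space M. workload (\<lambda>n. T n \<omega>) (\<lambda>n. S n \<omega>) x h \<le> z}) \<partial>\<pi>)"
proof -
  have "\<forall>t\<ge>0. \<forall>B\<in>sets borel. (\<integral>\<^sup>+x. emeasure M {\<omega> \<in> space M.
      workload (\<lambda>n. T n \<omega>) (\<lambda>n. S n \<omega>) x t \<in> B} \<partial>\<pi>) = emeasure \<pi> B"
    using invariant unfolding invariant_distribution_def by (elim conjE)
  from this[rule_format, OF assms, of "{..z}"]
  have "emeasure \<pi> {..z} = (\<integral>\<^sup>+x. emeasure M {\<omega> \<in> space M. workload (\<lambda>n. T n \<omega>) (\<lambda>n. S n \<omega>) x h \<le> z} \<partial>\<pi>)"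
    by simp
  then show ?thesis
    unfolding F_def cdf_def pi.emeasure_eq_measure emeasure_eq_measure .
qed

lemma integrable_step: "integrable \<pi> (\<lambda>x. a * indicator {..w} x + b * cdf G (v - x))"
  by (rule Bochner_Integration.integrable_add[OF
        integrable_mult_right[OF integrable_indicator_atMost] integrable_mult_right[OF integrable_cdf_G]])

lemma integral_step:
  "(LINT x|\<pi>. a * indicator {..w} x + b * cdf G (v - x)) = a * F w + b * K v"
  unfolding F_eq K_def
    Bochner_Integration.integral_add[OF
      integrable_mult_right[OF integrable_indicator_atMost] integrable_mult_right[OF integrable_cdf_G]]
  by (simp only: integral_mult_right_zero)

lemma F_step_lower:
  assumes "0 \<le> z" "0 < h" and q: "q = 1 - exp (- lambda * h)"
  shows "(1 - q) * F (z + h) + q * (1 - q) * K z \<le> F z"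
proof -
  let ?g = "\<lambda>x. (1 - q) * indicator {..z + h} x + q * (1 - q) * cdf G (z - x)"
  have "0 \<le> q" "q \<le> 1" using q lambda_pos \<open>0 < h\<close> by auto
  then have "0 \<le> ?g x" for x
    by (simp add: G.cdf_nonneg)
  then have "ennreal (LINT x|\<pi>. ?g x) = (\<integral>\<^sup>+x. ennreal (?g x) \<partial>\<pi>)"
    by (intro nn_integral_eq_integral[symmetric] integrable_step AE_I2)
  also have "\<dots> \<le> ennreal (F z)"
    unfolding F_invariant[OF less_imp_le[OF \<open>0 < h\<close>]]
  proof (rule nn_integral_mono_AE, use AE_pi in eventually_elim)
    fix x :: real assume "x \<in> {0..1}"
    then have "0 \<le> x" by simp
    from prob_workload_le_lower[OF assms(1,2) this q]
    show "ennreal (?g x) \<le> ennreal (prob {\<omega> \<in> space M. workload (\<lambda>n. T n \<omega>) (\<lambda>n. S n \<omega>) x h \<le> z})"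
      by (rule ennreal_leI)
  qed
  finally show ?thesis
    by (simp only: ennreal_le_iff[OF F_nonneg] integral_step)
qed

lemma F_step_upper:
  assumes "0 \<le> z" "0 < h" "z + h \<le> 1" and q: "q = 1 - exp (- lambda * h)"
  shows "F z \<le> (1 - q) * F (z + h) + q * K (z + h) + q * q"
proof -
  let ?g = "\<lambda>x. (1 - q) * indicator {..z + h} x + q * cdf G (z + h - x) + q * q"
  have "0 \<le> q" "q \<le> 1" using q lambda_pos \<open>0 < h\<close> by auto
  then have g_nonneg: "0 \<le> ?g x" for x
    by (simp add: G.cdf_nonneg)
  have integral_g: "(LINT x|\<pi>. ?g x) = (1 - q) * F (z + h) + q * K (z + h) + q * q"
    unfolding Bochner_Integration.integral_add[OF integrable_step pi.integrable_const] integral_step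
    by (simp add: pi.prob_space[simplified])
  have "ennreal (F z) \<le> (\<integral>\<^sup>+x. ennreal (?g x) \<partial>\<pi>)"
    unfolding F_invariant[OF less_imp_le[OF \<open>0 < h\<close>]]
    by (rule nn_integral_mono, rule ennreal_leI, rule prob_workload_le_upper[OF assms])
  also have "\<dots> = ennreal (LINT x|\<pi>. ?g x)"
    using g_nonneg by (intro nn_integral_eq_integral AE_I2
        Bochner_Integration.integrable_add[OF integrable_step pi.integrable_const])
  finally show ?thesis
    using Bochner_Integration.integral_nonneg[of \<pi> ?g, OF g_nonneg]
    by (simp only: integral_g ennreal_le_iff)
qed

end

section \<open>The invariant distribution\<close>

text \<open>With \<open>a = lambda * h\<close>, these say that the probability of an arrival within
  time \<open>h\<close> equals \<open>a\<close> up to \<open>a\<^sup>2\<close>.\<close>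

lemma one_minus_exp_uminus_bounds:
  fixes a :: real
  assumes "0 \<le> a"
  shows "1 - exp (- a) \<le> a" "a - a\<^sup>2 \<le> 1 - exp (- a)"
proof -
  show "1 - exp (- a) \<le> a" using exp_ge_add_one_self[of "- a"] by simp
  have "exp (- a) \<le> 1 / (1 + a)"
    using exp_ge_add_one_self[of a] assms by (simp add: exp_minus divide_inverse)
  also have "\<dots> \<le> 1 - a + a\<^sup>2"
    using assms by (simp add: field_simps power2_eq_square)
  finally show "a - a\<^sup>2 \<le> 1 - exp (- a)" by simp
qed

context mg1_invariant
begin

text \<open>The one-step inequalities with \<open>q\<close> replaced by its first-order value
  \<open>d\<close>. The arguments of \<open>F\<close> and \<open>K\<close> are taken at opposite
  ends so that, by monotonicity, \<open>d * (F x - K y)\<close> and \<open>d * (F y - K x)\<close>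
  also enclose the integral of \<open>p\<close> over \<open>{x..y}\<close>.\<close>

lemma F_increment:
  assumes "0 \<le> x" "x < y" "y \<le> 1"
  defines "d \<equiv> lambda * (y - x)"
  shows "d * (F x - K y) - 2 * d\<^sup>2 \<le> F y - F x" "F y - F x \<le> d * (F y - K x) + 2 * d\<^sup>2"
proof -
  define q where "q = 1 - exp (- lambda * (y - x))"
  have d0: "0 \<le> d" using lambda_pos assms by (simp add: d_def)
  have q: "q \<le> d" "d - d\<^sup>2 \<le> q" "0 \<le> q" "q \<le> 1"
    using one_minus_exp_uminus_bounds[OF d0] d0 by (auto simp: q_def d_def)
  have lower: "(1 - q) * F y + q * (1 - q) * K x \<le> F x"
    using F_step_lower[of x "y - x" q] assms by (simp add: q_def)
  have upper: "F x \<le> (1 - q) * F y + q * K y + q * q"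
    using F_step_upper[of x "y - x" q] assms by (simp add: q_def)
  have F01: "0 \<le> F z" "F z \<le> 1" and K01: "0 \<le> K z" "K z \<le> 1" for z
    using F_nonneg F_le_1 K_nonneg K_le_F[of z] order_trans by blast+
  have mono: "F x \<le> F y" using assms by (intro F_mono) simp
  have qq: "q\<^sup>2 \<le> d\<^sup>2" using q by (intro power_mono) auto
  have "F y - F x \<le> q * (F y - K x) + q\<^sup>2 * K x"
    using lower by (simp add: algebra_simps power2_eq_square)
  also have "\<dots> \<le> d * (F y - K x) + d\<^sup>2 * 1"
    using qq q K01 mono K_le_F[of x] by (intro add_mono mult_mono mult_right_mono) auto
  finally show "F y - F x \<le> d * (F y - K x) + 2 * d\<^sup>2"
    using zero_le_power2[of d] by linarith
  \<comment> \<open>One \<open>d\<^sup>2\<close> absorbs the difference between \<open>d\<close> and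
    \<open>q\<close>, the other the double arrivals \<open>q\<^sup>2\<close>.\<close>
  have "d * (F x - K y) - 2 * d\<^sup>2 \<le> d * (F y - K y) - d\<^sup>2 * (F y - K y) - d\<^sup>2"
    using mult_left_mono[OF mono d0] mult_left_mono[of "F y - K y" 1 "d\<^sup>2"] F01[of y] K01[of y]
    by (simp add: algebra_simps)
  also have "\<dots> \<le> q * (F y - K y) - q\<^sup>2"
    using mult_right_mono[OF q(2), of "F y - K y"] K_le_F[of y] qq by (simp add: algebra_simps)
  also have "\<dots> \<le> F y - F x"
    using upper by (simp add: algebra_simps power2_eq_square)
  finally show "d * (F x - K y) - 2 * d\<^sup>2 \<le> F y - F x" .
qed

lemma p_nonneg: "0 \<le> p x"
  using K_le_F lambda_pos by (simp add: p_def)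

lemma p_le: "p x \<le> lambda"
  using F_le_1[of x] K_nonneg[of x] lambda_pos by (simp add: p_def mult_left_le)

lemma measurable_p [measurable]: "p \<in> borel_measurable borel"
proof -
  have [measurable]: "F \<in> borel_measurable borel" "K \<in> borel_measurable borel"
    by (auto intro!: borel_measurable_mono monoI F_mono K_mono)
  show ?thesis unfolding p_def by measurable
qed

lemma set_integrable_p: "set_integrable lborel {a..b} p"
  by (rule set_integrable_Icc_bounded[where C = lambda]) (use p_nonneg p_le in auto)

lemma set_integral_p_split:
  "a \<le> b \<Longrightarrow> b \<le> c \<Longrightarrow> (LINT y:{a..c}|lborel. p y) = (LINT y:{a..b}|lborel. p y) + (LINT y:{b..c}|lborel. p y)"
proof -
  assume "a \<le> b" "b \<le> c"
  then have "{a..c} = {a..b} \<union> {b..c}" by auto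
  then show ?thesis
    using AE_lborel_singleton[of b] set_integrable_p
    by (simp only:) (intro set_integral_Un_AE, auto elim!: eventually_mono)
qed

text \<open>By the one-step bounds, the increments of \<open>\<lambda>z. F z - (LINT y:{0..z}|lborel. p y)\<close> are at most the
  step width times those of a fixed function; no differentiability of \<open>F\<close> or continuity of \<open>K\<close> is
  involved.\<close>

lemma F_eq_integral_p:
  assumes "x \<in> {0..1}"
  shows "F x = F 0 + (LINT y:{0..x}|lborel. p y)"
proof -
  define D where "D z = F z - (LINT y:{0..z}|lborel. p y)" for z
  have "D x = D 0"
  proof (rule eq_if_increments_le_mono[where D = D and a = 0 and b = x and \<Psi> = "\<lambda>z. lambda * (F z + K z) + 2 * lambda\<^sup>2 * z"])
    show "0 \<le> x" using assms by simp
    fix a b assume ab: "0 \<le> a" "a < b" "b \<le> x"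
    define d where "d = lambda * (b - a)"
    have const: "(LINT y:{a..b}|lborel. c) = (b - a) * c" for c :: real
      using ab by (simp add: set_lebesgue_integral_def)
    have intc: "set_integrable lborel {a..b} (\<lambda>_. c)" for c :: real
      by (intro borel_integrable_atLeastAtMost' continuous_intros)
    have p_bounds: "lambda * (F a - K b) \<le> p y" "p y \<le> lambda * (F b - K a)" if "y \<in> {a..b}" for y
      using that F_mono[of a y] F_mono[of y b] K_mono[of a y] K_mono[of y b] lambda_pos
      unfolding p_def by (auto intro!: mult_left_mono)
    have "d * (F a - K b) \<le> (LINT y:{a..b}|lborel. p y)" "(LINT y:{a..b}|lborel. p y) \<le> d * (F b - K a)"
      using set_integral_mono[OF intc set_integrable_p p_bounds(1)] set_integral_mono[OF set_integrable_p intc p_bounds(2)]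
      by (simp_all only: d_def const mult_ac)
    moreover have "d * (F a - K b) - 2 * d\<^sup>2 \<le> F b - F a" "F b - F a \<le> d * (F b - K a) + 2 * d\<^sup>2"
      using F_increment[of a b] ab assms by (simp_all add: d_def)
    moreover have "D b - D a = F b - F a - (LINT y:{a..b}|lborel. p y)"
      using set_integral_p_split[of 0 a b] ab by (simp add: D_def)
    ultimately have "\<bar>D b - D a\<bar> \<le> d * (F b - K a) - d * (F a - K b) + 2 * d\<^sup>2"
      by (simp add: abs_le_iff)
    \<comment> \<open>The gap between upper and lower bound is \<open>d\<close> times the increment
      of \<open>F + K\<close>, and \<open>d\<close> is proportional to \<open>b - a\<close>; this
      dictates the choice of \<open>\<Psi>\<close>, whose linear term accounts for
      \<open>2 * d\<^sup>2\<close>.\<close>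
    also have "\<dots> = (b - a) * (lambda * (F b + K b) + 2 * lambda\<^sup>2 * b - (lambda * (F a + K a) + 2 * lambda\<^sup>2 * a))"
      by (simp add: d_def power2_eq_square algebra_simps)
    finally show "\<bar>D b - D a\<bar> \<le> (b - a) * ((lambda * (F b + K b) + 2 * lambda\<^sup>2 * b) - (lambda * (F a + K a) + 2 * lambda\<^sup>2 * a))" .
  qed
  moreover have "(LINT y:{0..0}|lborel. p y) = 0"
    using set_integral_p_split[of 0 0 0] by simp
  ultimately show ?thesis by (simp add: D_def)
qed

section \<open>Density on the half-open interval, atom at 0 and renewal equation\<close>

lemma F_1: "F 1 = 1"
proof -
  have "measure \<pi> {..1} = 1"
    by (subst pi.prob_eq_1) (use AE_pi in \<open>auto elim!: eventually_mono\<close>)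
  then show ?thesis by (simp add: F_def cdf_def)
qed

lemma measure_pi_Icc: "measure \<pi> {0..x} = F x"
  unfolding F_def cdf_def
  by (rule pi.finite_measure_eq_AE) (use AE_pi in \<open>auto elim!: eventually_mono\<close>)

text \<open>Cutting off by indicators keeps both measures on the whole line, where finite Borel
  measures are determined by the rays \<open>{x<..}\<close>. On such a ray both sides equal
  \<open>F 1 - F m\<close>.\<close>

lemma density_pi:
  "density \<pi> (\<lambda>x. ennreal (indicator {0<..1} x)) = density lborel (\<lambda>x. ennreal (p x * indicator {0<..1} x))"
    (is "?L = ?R")
proof (rule measure_eqI_lessThan)
  fix x :: real
  \<comment> \<open>Clamping \<open>x\<close> to \<open>{0..1}\<close> leaves the intersection of
    the ray with \<open>{0<..1}\<close> equal to \<open>{m<..1}\<close> for every real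
    \<open>x\<close>.\<close>
  define m where "m = max 0 (min x 1)"
  have m: "m \<in> {0..1}" by (simp add: m_def)
  have "emeasure ?L {x<..} = (\<integral>\<^sup>+y. ennreal (indicator {0<..1} y) * indicator {x<..} y \<partial>\<pi>)"
    by (subst emeasure_density) auto
  also have "\<dots> = (\<integral>\<^sup>+y. indicator {m<..1} y \<partial>\<pi>)"
    by (intro nn_integral_cong) (auto simp: m_def split: split_indicator)
  also have "\<dots> = ennreal (F 1 - F m)"
    using m pi.cdf_diff_eq[of m 1] by (simp add: pi.emeasure_eq_measure F_def) (cases "m = 1"; simp)
  finally have L: "emeasure ?L {x<..} = ennreal (F 1 - F m)" .
  then show "emeasure ?L {x<..} < \<infinity>" by simp
  have "emeasure ?R {x<..} = (\<integral>\<^sup>+y. ennreal (p y * indicator {0<..1} y) * indicator {x<..} y \<partial>lborel)"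
    by (subst emeasure_density) auto
  also have "\<dots> = (\<integral>\<^sup>+y. ennreal (indicator {m..1} y * p y) \<partial>lborel)"
    by (intro nn_integral_cong_AE, use AE_lborel_singleton[of m] in eventually_elim)
      (auto simp: m_def split: split_indicator)
  also have "\<dots> = ennreal (LINT y:{m..1}|lborel. p y)"
    using set_integrable_p[of m 1] p_nonneg unfolding set_integrable_def set_lebesgue_integral_def
    by (subst nn_integral_eq_integral) auto
  also have "(LINT y:{m..1}|lborel. p y) = F 1 - F m"
    using F_eq_integral_p[of 1] F_eq_integral_p[OF m] set_integral_p_split[of 0 m 1] m by simp
  finally show "emeasure ?L {x<..} = emeasure ?R {x<..}" using L by simp
qed auto

lemma restrict_pi:
  "restrict_space \<pi> {0<..1} = density (restrict_space lborel {0<..1}) (\<lambda>x. ennreal (p x))"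
proof (rule measure_eqI)
  show "sets (restrict_space \<pi> {0<..1}) = sets (density (restrict_space lborel {0<..1}) (\<lambda>x. ennreal (p x)))"
    by (simp add: sets_restrict_space)
  fix B assume "B \<in> sets (restrict_space \<pi> {0<..1})"
  then have B: "B \<subseteq> {0<..1}" "B \<in> sets borel" by (auto simp: sets_restrict_space)
  then have B': "B \<in> sets (restrict_space lborel {0<..1})" by (auto simp: sets_restrict_space image_iff)
  have "emeasure (restrict_space \<pi> {0<..1}) B = (\<integral>\<^sup>+y. indicator B y \<partial>\<pi>)"
    using B by (subst emeasure_restrict_space) auto
  also have "\<dots> = (\<integral>\<^sup>+y. ennreal (indicator {0<..1} y) * indicator B y \<partial>\<pi>)"
    using B by (intro nn_integral_cong) (auto split: split_indicator)
  also have "\<dots> = emeasure (density \<pi> (\<lambda>x. ennreal (indicator {0<..1} x))) B"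
    using B by (subst emeasure_density) auto
  also have "\<dots> = (\<integral>\<^sup>+y. ennreal (p y * indicator {0<..1} y) * indicator B y \<partial>lborel)"
    unfolding density_pi using B by (subst emeasure_density) auto
  also have "\<dots> = (\<integral>\<^sup>+y. (ennreal (p y) * indicator B y) * indicator {0<..1} y \<partial>lborel)"
    using B by (intro nn_integral_cong) (auto split: split_indicator)
  also have "\<dots> = emeasure (density (restrict_space lborel {0<..1}) (\<lambda>x. ennreal (p x))) B"
    using B' by (subst emeasure_density)
      (auto simp: nn_integral_restrict_space intro!: measurable_restrict_space1)
  finally show "emeasure (restrict_space \<pi> {0<..1}) B = emeasure (density (restrict_space lborel {0<..1}) (\<lambda>x. ennreal (p x))) B" .
qed

text \<open>The integral in \<open>F_minus_K\<close> is split at the atom: the point 0 contributes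
  \<open>F 0 * tail G z\<close>, and on \<open>{0<..1}\<close> the law has density \<open>p\<close>,
  which yields the convolution.\<close>

lemma p_renewal:
  assumes z: "z \<in> {0..1}"
  shows "p z = lambda * (F 0 * tail G z + conv (tail G) p z)"
proof -
  let ?g = "\<lambda>x. indicator {..z} x * tail G (z - x)"
  have le: "\<bar>?g x\<bar> \<le> 1" for x
    using abs_tail_le by (auto split: split_indicator)
  have int: "integrable \<pi> (\<lambda>x. indicator A x * ?g x)" if "A \<in> sets borel" for A
    using that le by (intro integrable_bounded[where C = 1]) (auto simp: abs_mult split: split_indicator)
  have "(LINT x|\<pi>. ?g x) = (LINT x|\<pi>. indicator {0} x * ?g x + indicator {0<..1} x * ?g x)"
  proof (rule integral_cong_AE)
    show "AE x in \<pi>. ?g x = indicator {0} x * ?g x + indicator {0<..1} x * ?g x"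
      using AE_pi by eventually_elim (auto split: split_indicator)
  qed auto
  also have "\<dots> = (LINT x|\<pi>. indicator {0} x * ?g x) + (LINT x|\<pi>. indicator {0<..1} x * ?g x)"
    by (intro Bochner_Integration.integral_add int) auto
  \<comment> \<open>Writing the point as \<open>{0..0}\<close> lets \<open>measure_pi_Icc\<close>
    identify its mass with \<open>F 0\<close>.\<close>
  also have "(LINT x|\<pi>. indicator {0} x * ?g x) = (LINT x|\<pi>. indicator {0..0} x * tail G z)"
    using z by (intro Bochner_Integration.integral_cong) (auto split: split_indicator)
  also have "\<dots> = F 0 * tail G z"
    by (subst measure_pi_Icc[symmetric]) simp
  also have "(LINT x|\<pi>. indicator {0<..1} x * ?g x) = (LINT x|density \<pi> (\<lambda>x. ennreal (indicator {0<..1} x)). ?g x)"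
    by (subst integral_density) auto
  also have "\<dots> = (LINT x|lborel. p x * indicator {0<..1} x * ?g x)"
    unfolding density_pi using p_nonneg by (subst integral_density) (auto split: split_indicator)
  \<comment> \<open>As \<open>z \<le> 1\<close>, the domains \<open>{0<..1}\<close> cut at
    \<open>z\<close> and \<open>{0..z}\<close> differ only in the null set of the point 0.\<close>
  also have "\<dots> = conv (tail G) p z"
    unfolding conv_def set_lebesgue_integral_def
    by (intro integral_cong_AE)
      (use AE_lborel_singleton[of 0] z in \<open>auto elim!: eventually_mono split: split_indicator\<close>)
  finally show ?thesis by (simp add: p_def F_minus_K)
qed

end

theorem theorem1:
  fixes M :: "'a measure" and lambda :: real and G \<pi> :: "real measure"
    and T S :: "nat \<Rightarrow> 'a \<Rightarrow> real"
  assumes "mg1_input M lambda G T S"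
    and "invariant_distribution M T S \<pi>"
  shows
    "let a = (\<lambda>i x. lambda ^ i * conv_power (tail G) i x);
         b = (\<lambda>i x. lambda ^ i * (LINT y:{0..x}|lborel. conv_power (tail G) i y))
     in (\<forall>x\<in>{0..1}. summable (\<lambda>i. a (Suc i) x) \<and> summable (\<lambda>i. b (Suc i) x)) \<and>
        restrict_space \<pi> {0<..1} =
          density (restrict_space lborel {0<..1})
            (\<lambda>x. ennreal ((\<Sum>i. a (Suc i) x) / (1 + (\<Sum>i. b (Suc i) 1)))) \<and>
        (\<forall>x\<in>{0..1}. measure \<pi> {0..x} =
           (1 + (\<Sum>i. b (Suc i) x)) / (1 + (\<Sum>i. b (Suc i) 1)))"
proof -
  interpret mg1_invariant M lambda G T S \<pi>
    using assms by (intro mg1_invariant.intro mg1_invariant_axioms.intro)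
  define a where "a i x = lambda ^ i * conv_power (tail G) i x" for i x
  define b where "b i x = lambda ^ i * (LINT y:{0..x}|lborel. conv_power (tail G) i y)" for i x
  define B where "B x = 1 + (\<Sum>i. b (Suc i) x)" for x
  have lambda0: "0 \<le> lambda" using lambda_pos by simp
  have p_abs: "\<bar>p x\<bar> \<le> lambda" for x using p_nonneg p_le by simp
  have a_summable: "summable (\<lambda>i. a (Suc i) x)" and b_summable: "summable (\<lambda>i. b (Suc i) x)"
    if "x \<in> {0..1}" for x
    unfolding a_def b_def using that lambda0
    by (auto simp del: power_Suc intro!: summable_conv_power summable_integral_conv_power abs_tail_le)
  have p_eq: "p x = F 0 * (\<Sum>i. a (Suc i) x)" if "x \<in> {0..1}" for x
  proof -
    have "(\<lambda>i. F 0 * a (Suc i) x) sums p x"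
      \<comment> \<open>The Neumann series with kernel \<open>tail G\<close>, factor
        \<open>lambda\<close> and the mass \<open>F 0\<close> of the atom as
        \<open>u\<close>.\<close>
      unfolding a_def using renewal_solution_sums[OF measurable_tail abs_tail_le measurable_p p_abs lambda0 p_renewal that] .
    from sums_unique[OF this] show ?thesis
      using suminf_mult[OF a_summable[OF that]] by simp
  qed
  have F_eq: "F x = F 0 * B x" if "x \<in> {0..1}" for x
  proof -
    have "(\<lambda>i. F 0 * b (Suc i) x) sums (LINT y:{0..x}|lborel. p y)"
      unfolding b_def using renewal_solution_integral_sums[OF measurable_tail abs_tail_le measurable_p p_abs lambda0 p_renewal that] .
    from sums_unique[OF this] show ?thesis
      using suminf_mult[OF b_summable[OF that]] F_eq_integral_p[OF that] by (simp add: B_def distrib_left)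
  qed
  \<comment> \<open>Total mass 1 determines the atom; it also shows \<open>B 1\<close> to be
    nonzero, so the division is a genuine one.\<close>
  have "F 0 * B 1 = 1" using F_eq[of 1] F_1 by simp
  then have F0: "F 0 = 1 / B 1" by (metis div_by_0 nonzero_eq_divide_eq mult_zero_right zero_neq_one)
  have "restrict_space \<pi> {0<..1} = density (restrict_space lborel {0<..1}) (\<lambda>x. ennreal ((\<Sum>i. a (Suc i) x) / B 1))"
  proof -
    \<comment> \<open>The equality \<open>p_eq\<close> holds only on \<open>{0..1}\<close>;
      replacing the density under \<open>density_cong\<close> therefore calls for measurability of
      the series itself.\<close>
    have [measurable]: "a i \<in> borel_measurable borel" for i
      unfolding a_def using borel_measurable_conv_power[OF measurable_tail abs_tail_le] by measurable
    show ?thesis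
      unfolding restrict_pi
      by (intro density_cong) (auto simp: p_eq F0 space_restrict_space intro!: measurable_restrict_space1)
  qed
  moreover have "measure \<pi> {0..x} = B x / B 1" if "x \<in> {0..1}" for x
    using F_eq[OF that] by (simp add: measure_pi_Icc F0)
  ultimately show ?thesis
    using a_summable b_summable unfolding a_def[symmetric] b_def[symmetric] B_def[symmetric] Let_def by simp
qed

end
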